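(* Let $R>0$, let $N\ge 1$ be an integer, let $0<T<R$, and let $f\colon\mathbb{R}^N\to\mathbb{R}^N$ be continuous. Suppose $|f(x)|=O(|x|^\alpha)$ as $|x|\to\infty$ for some $\alpha\ge 1$. For $r\in[T,R]$ and $\phi\in\mathcal{L}^\alpha([-R,0],\mathbb{R}^N)$, let $x(\cdot;\phi,r)$ be the solution of $\dot x(t)=f(x(t-r))$ $(t\ge 0)$, $x(t)=\phi(t)$ $(t\in[-R,0])$, and define $y(\cdot;\phi,r)$ by the decomposition $x(\cdot;\phi,r)=y(\cdot;\phi,r)+\bar\phi$, where $\bar\phi$ is the static prolongation of $\phi$. Then the map $$\mathcal{L}^\alpha([-R,0],\mathbb{R}^N)\ni\phi\mapsto y(\cdot;\phi,r)\in C([-R,T],\mathbb{R}^N)$$ (with $y(\cdot;\phi,r)$ restricted to $[-R,T]$) is continuous uniformly in $r\in[T,R]$.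
   Context: $|\cdot|$ is a fixed norm on $\mathbb{R}^N$. $\mathcal{L}^p([a,b],\mathbb{R}^N)$ ($1\le p<\infty$) is the linear space of Lebesgue measurable functions $\phi\colon[a,b]\to\mathbb{R}^N$ (actual functions, not equivalence classes) with $\int_a^b|\phi|^p<\infty$, endowed with the seminorm $\|\phi\|_{L^p[a,b]}=(\int_a^b|\phi(\theta)|^p\,d\theta)^{1/p}$. $C([a,b],\mathbb{R}^N)$ carries the supremum norm. Static prolongation: for $\phi\colon[-R,0]\to\mathbb{R}^N$, $\bar\phi\colon[-R,\infty)\to\mathbb{R}^N$ is given by $\bar\phi(t)=\phi(t)$ for $t\in[-R,0]$ and $\bar\phi(t)=\phi(0)$ for $t\ge 0$. Solution: $x(\cdot;\phi,r)\colon[-R,\infty)\to\mathbb{R}^N$ is the unique function which equals $\phi$ on $[-R,0]$, is continuous on $[0,\infty)$, and satisfies $x(t)=\phi(0)+\int_0^t f(x(s-r))\,ds$ for all $t\ge 0$ (constructed by the method of steps; on $[0,r]$ it equals $\phi(0)+\int_0^t f(\phi(s-r))\,ds$). "Continuous uniformly in $r\in[T,R]$" means: for every $\phi_0$ and every $\varepsilon>0$ there is $\delta>0$, independent of $r\in[T,R]$, such that if $\phi$ is within $\delta$ of $\phi_0$ then the images of $\phi$ and $\phi_0$ are within $\varepsilon$ of each other for all $r\in[T,R]$. $|f(x)|=O(|x|^\alpha)$ as $|x|\to\infty$ means that there are $C,K>0$ with $|f(x)|\le C|x|^\alpha$ whenever $|x|\ge K$. *)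

theory Defs
  imports "HOL-Analysis.Analysis"
begin

definition is_norm :: "('a::real_vector \<Rightarrow> real) \<Rightarrow> bool" where
  "is_norm nrm \<longleftrightarrow>
     (\<forall>x. 0 \<le> nrm x) \<and>
     (\<forall>x. nrm x = 0 \<longleftrightarrow> x = 0) \<and>
     (\<forall>c x. nrm (c *\<^sub>R x) = \<bar>c\<bar> * nrm x) \<and>
     (\<forall>x y. nrm (x + y) \<le> nrm x + nrm y)"

text \<open>
  A function on an interval is represented by a total function on the reals; its values outside
  the interval are irrelevant to everything below. There is no identification of functions that
  agree almost everywhere.
\<close>

definition Lp_space ::
  "(real^'n \<Rightarrow> real) \<Rightarrow> real \<Rightarrow> real \<Rightarrow> real \<Rightarrow> (real \<Rightarrow> real^'n) set" where
  "Lp_space nrm p a b =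
     {\<phi>. \<phi> \<in> borel_measurable (lebesgue_on {a..b}) \<and>
         integrable (lebesgue_on {a..b}) (\<lambda>\<theta>. nrm (\<phi> \<theta>) powr p)}"

definition Lp_seminorm ::
  "(real^'n \<Rightarrow> real) \<Rightarrow> real \<Rightarrow> real \<Rightarrow> real \<Rightarrow> (real \<Rightarrow> real^'n) \<Rightarrow> real" where
  "Lp_seminorm nrm p a b \<phi> =
     (LINT \<theta>|lebesgue_on {a..b}. nrm (\<phi> \<theta>) powr p) powr (1 / p)"

text \<open>Meaningful for continuous \<open>u\<close>; the supremum of an unbounded set of reals is unspecified.\<close>

definition sup_norm ::
  "(real^'n \<Rightarrow> real) \<Rightarrow> real \<Rightarrow> real \<Rightarrow> (real \<Rightarrow> real^'n) \<Rightarrow> real" where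
  "sup_norm nrm a b u = (SUP t\<in>{a..b}. nrm (u t))"

definition static_prolongation :: "(real \<Rightarrow> real^'n) \<Rightarrow> real \<Rightarrow> real^'n" where
  "static_prolongation \<phi> t = (if t \<le> 0 then \<phi> t else \<phi> 0)"

text \<open>
  The Bochner integral of a non-integrable function is \<open>0\<close> by convention, so the existence of the
  integral in the integral equation is required explicitly. Membership in \<open>extensional {- R..}\<close>
  fixes the values to the left of \<open>- R\<close>, so that there can be a unique such total function.
\<close>

definition is_solution ::
  "(real^'n \<Rightarrow> real^'n) \<Rightarrow> real \<Rightarrow> (real \<Rightarrow> real^'n) \<Rightarrow> real \<Rightarrow> (real \<Rightarrow> real^'n) \<Rightarrow> bool" where
  "is_solution f R \<phi> r x \<longleftrightarrow>
     x \<in> extensional {- R..} \<and>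
     (\<forall>t\<in>{- R..0}. x t = \<phi> t) \<and>
     continuous_on {0..} x \<and>
     (\<forall>t\<ge>0. integrable (lebesgue_on {0..t}) (\<lambda>s. f (x (s - r))) \<and>
            x t = \<phi> 0 + (LINT s|lebesgue_on {0..t}. f (x (s - r))))"

definition solution ::
  "(real^'n \<Rightarrow> real^'n) \<Rightarrow> real \<Rightarrow> (real \<Rightarrow> real^'n) \<Rightarrow> real \<Rightarrow> real \<Rightarrow> real^'n" where
  "solution f R \<phi> r = (THE x. is_solution f R \<phi> r x)"

text \<open>The component \<open>y\<close> in the decomposition \<open>x = y + static_prolongation \<phi>\<close>.\<close>

definition solution_y ::
  "(real^'n \<Rightarrow> real^'n) \<Rightarrow> real \<Rightarrow> (real \<Rightarrow> real^'n) \<Rightarrow> real \<Rightarrow> real \<Rightarrow> real^'n" where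
  "solution_y f R \<phi> r t = solution f R \<phi> r t - static_prolongation \<phi> t"

end

theory Submission imports Defs begin

text \<open>
  On \<open>[0, T]\<close> the delayed argument \<open>s - r\<close> of the right-hand side never exceeds \<open>T - r \<le> 0\<close>, so only the
  history enters the integral equation there: \<open>y(t; \<phi>, r) = \<integral> f(\<phi>(s)) ds\<close> over \<open>[- r, t - r]\<close>
  (\<open>solution_y_first_step\<close>). Since \<open>[- r, t - r]\<close> lies in \<open>[- R, 0]\<close>, the difference
  \<open>y(t; \<phi>, r) - y(t; \<phi>\<^sub>0, r)\<close> is bounded, for all \<open>r\<close> and \<open>t\<close> at once, by the \<open>L\<^sup>1\<close> distance of \<open>f \<circ> \<phi>\<close> and
  \<open>f \<circ> \<phi>\<^sub>0\<close> on \<open>[- R, 0]\<close>. The uniformity in \<open>r\<close> thus costs nothing, and what remains is the continuity of the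
  superposition operator \<open>\<phi> \<mapsto> f \<circ> \<phi>\<close> from \<open>L\<^sup>\<alpha>\<close> to \<open>L\<^sup>1\<close>.
  
  That continuity (\<open>superposition_continuous_L1\<close>) follows from the growth bound and dominated convergence.
  If it failed, there would be \<open>\<phi>\<^sub>n\<close> with \<open>\<integral>|\<phi>\<^sub>n - \<phi>\<^sub>0|\<^sup>\<alpha> < 2\<^sup>-\<^sup>n\<close> but \<open>f \<circ> \<phi>\<^sub>n\<close> bounded away from \<open>f \<circ> \<phi>\<^sub>0\<close>
  in \<open>L\<^sup>1\<close>. The series \<open>\<Sum>|\<phi>\<^sub>n - \<phi>\<^sub>0|\<^sup>\<alpha>\<close> then has finite integral; so it converges almost everywhere, which makes
  \<open>\<phi>\<^sub>n \<rightarrow> \<phi>\<^sub>0\<close> almost everywhere, and its sum yields an integrable majorant for \<open>f \<circ> \<phi>\<^sub>n\<close>.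
  
  The solution is defined by a definite description, which has a meaning only once existence and uniqueness on
  all of \<open>[- R, \<infinity>)\<close> are known; the method of steps gives both. All estimates are carried out in the Euclidean norm,
  to which the given norm is equivalent.
\<close>

section \<open>Equivalence of norms\<close>

text \<open>
  A norm is convex, and convex functions on a finite-dimensional space are continuous. Its minimum and
  maximum on the compact Euclidean unit sphere then give the two bounds by scaling; a single constant
  serves for both directions.
\<close>

lemma is_norm_equivalent:
  fixes nrm :: "'a::euclidean_space \<Rightarrow> real"
  assumes "is_norm nrm"
  obtains c where "continuous_on UNIV nrm" "0 < c" "\<And>x. nrm x \<le> c * norm x" "\<And>x. norm x \<le> c * nrm x"
proof -
  have nonneg: "0 \<le> nrm x" and zero: "nrm x = 0 \<longleftrightarrow> x = 0"
    and scale: "nrm (s *\<^sub>R x) = \<bar>s\<bar> * nrm x" and tri: "nrm (x + y) \<le> nrm x + nrm y" for x y s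
    using assms by (auto simp: is_norm_def)
  have "convex_on UNIV nrm"
  proof (rule convex_onI)
    fix t :: real and x y :: 'a
    assume "0 < t" "t < 1"
    then show "nrm ((1 - t) *\<^sub>R x + t *\<^sub>R y) \<le> (1 - t) * nrm x + t * nrm y"
      using tri[of "(1 - t) *\<^sub>R x" "t *\<^sub>R y"] by (simp add: scale)
  qed simp
  then have cont_UNIV: "continuous_on UNIV nrm"
    by (rule convex_on_continuous[OF open_UNIV])
  then have cont: "continuous_on (sphere 0 1) nrm"
    by (rule continuous_on_subset) simp
  have cpt: "compact (sphere (0::'a) 1)" and ne: "sphere (0::'a) 1 \<noteq> {}"
    by auto
  obtain u where u: "u \<in> sphere 0 1" "\<And>x. x \<in> sphere 0 1 \<Longrightarrow> nrm u \<le> nrm x"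
    using continuous_attains_inf[OF cpt ne cont] by blast
  obtain v where v: "v \<in> sphere 0 1" "\<And>x. x \<in> sphere 0 1 \<Longrightarrow> nrm x \<le> nrm v"
    using continuous_attains_sup[OF cpt ne cont] by blast
  have u0: "0 < nrm u"
    using u(1) nonneg[of u] zero[of u] by (auto simp: less_le)
  have lower: "nrm u * norm x \<le> nrm x" and upper: "nrm x \<le> nrm v * norm x" for x
  proof -
    let ?e = "x /\<^sub>R norm x"
    have "nrm u * norm x \<le> nrm ?e * norm x \<and> nrm ?e * norm x \<le> nrm v * norm x" if "x \<noteq> 0"
      using u(2)[of ?e] v(2)[of ?e] that by (simp add: mult_right_mono)
    moreover have "nrm ?e * norm x = nrm x" if "x \<noteq> 0"
      using that by (simp add: scale)
    ultimately show "nrm u * norm x \<le> nrm x" "nrm x \<le> nrm v * norm x"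
      using zero[of x] by (cases "x = 0"; simp)+
  qed
  show thesis
  proof
    show "continuous_on UNIV nrm"
      by (rule cont_UNIV)
    show "0 < max (nrm v) (1 / nrm u)"
      using u0 by (simp add: less_max_iff_disj)
    show "nrm x \<le> max (nrm v) (1 / nrm u) * norm x" for x
      using upper[of x] mult_right_mono[of "nrm v" "max (nrm v) (1 / nrm u)" "norm x"] by simp
    show "norm x \<le> max (nrm v) (1 / nrm u) * nrm x" for x
    proof -
      have "norm x \<le> 1 / nrm u * nrm x"
        using lower[of x] u0 by (simp add: field_simps)
      also have "\<dots> \<le> max (nrm v) (1 / nrm u) * nrm x"
        using nonneg[of x] by (intro mult_right_mono) simp_all
      finally show ?thesis .
    qed
  qed
qed

section \<open>The superposition operator from \<open>L\<^sup>p\<close> to \<open>L\<^sup>1\<close>\<close>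

text \<open>
  By monotone convergence the sum of the series, taken in \<open>[0, \<infinity>]\<close>, has finite integral, and so it is
  finite almost everywhere.
\<close>

lemma AE_summable_if_summable_integral:
  fixes g :: "nat \<Rightarrow> 'a \<Rightarrow> real"
  assumes int: "\<And>n. integrable M (g n)" and nonneg: "\<And>n x. 0 \<le> g n x"
    and sums: "summable (\<lambda>n. integral\<^sup>L M (g n))"
  shows "AE x in M. summable (\<lambda>n. g n x)"
proof -
  have [measurable]: "g n \<in> borel_measurable M" for n
    using int by auto
  have "(\<integral>\<^sup>+x. (\<Sum>n. ennreal (g n x)) \<partial>M) = (\<Sum>n. \<integral>\<^sup>+x. ennreal (g n x) \<partial>M)"
    by (intro nn_integral_suminf) simp
  also have "\<dots> = (\<Sum>n. ennreal (integral\<^sup>L M (g n)))"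
    by (intro arg_cong[where f=suminf] ext nn_integral_eq_integral int) (simp add: nonneg)
  also have "\<dots> \<noteq> \<infinity>"
    using sums nonneg by (simp add: ennreal_suminf_neq_top integral_nonneg_AE)
  finally have "AE x in M. (\<Sum>n. ennreal (g n x)) \<noteq> \<infinity>"
    by (intro nn_integral_PInf_AE) auto
  then show ?thesis
    by eventually_elim (simp add: nonneg summable_suminf_not_top)
qed

text \<open>
  A substitute for the triangle inequality after raising to the power \<open>p\<close>; the larger of \<open>norm b\<close> and
  \<open>norm (a - b)\<close> is at least half of \<open>norm a\<close>.
\<close>

lemma norm_powr_le_sum:
  fixes a b :: "'a::real_normed_vector"
  assumes "0 \<le> p"
  shows "norm a powr p \<le> 2 powr p * (norm b powr p + norm (a - b) powr p)"
proof -
  let ?m = "max (norm b) (norm (a - b))"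
  have "norm a \<le> 2 * ?m"
    using norm_triangle_ineq[of b "a - b"] by simp
  then have "norm a powr p \<le> (2 * ?m) powr p"
    using assms by (intro powr_mono2) auto
  also have "\<dots> = 2 powr p * ?m powr p"
    by (simp add: powr_mult)
  also have "?m powr p \<le> norm b powr p + norm (a - b) powr p"
    by (simp add: max_def)
  finally show ?thesis
    by simp
qed

lemma integrable_norm_diff_powr:
  fixes \<phi> \<psi> :: "'a \<Rightarrow> 'b::euclidean_space"
  assumes [measurable]: "\<phi> \<in> borel_measurable M" "\<psi> \<in> borel_measurable M"
    and int: "integrable M (\<lambda>s. norm (\<phi> s) powr p)" "integrable M (\<lambda>s. norm (\<psi> s) powr p)"
    and p: "0 \<le> p"
  shows "integrable M (\<lambda>s. norm (\<phi> s - \<psi> s) powr p)"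
proof (rule Bochner_Integration.integrable_bound)
  show "integrable M (\<lambda>s. 2 powr p * (norm (\<psi> s) powr p + norm (\<phi> s) powr p))"
    using int by simp
  show "AE s in M. norm (norm (\<phi> s - \<psi> s) powr p) \<le> norm (2 powr p * (norm (\<psi> s) powr p + norm (\<phi> s) powr p))"
    using norm_powr_le_sum[OF p, of "\<phi> s - \<psi> s" "- \<psi> s" for s] by simp
qed measurable

lemma (in finite_measure) superposition_integrable:
  fixes f :: "'b::euclidean_space \<Rightarrow> 'c::euclidean_space"
  assumes f: "continuous_on UNIV f"
    and growth: "\<And>x. norm (f x) \<le> A + B * norm x powr p"
    and \<phi>: "\<phi> \<in> borel_measurable M" "integrable M (\<lambda>s. norm (\<phi> s) powr p)"
  shows "integrable M (\<lambda>s. f (\<phi> s))"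
proof (rule Bochner_Integration.integrable_bound)
  show "integrable M (\<lambda>s. A + B * norm (\<phi> s) powr p)"
    using \<phi>(2) by simp
  show "(\<lambda>s. f (\<phi> s)) \<in> borel_measurable M"
    using borel_measurable_continuous_onI[OF f] \<phi>(1) by simp
  show "AE s in M. norm (f (\<phi> s)) \<le> norm (A + B * norm (\<phi> s) powr p)"
    using growth by (auto intro: order_trans[OF growth abs_ge_self])
qed

text \<open>
  The argument is by contradiction, with a sequence that converges in \<open>L\<^sup>p\<close> at a summable rate. This
  rate replaces the passage to an almost everywhere convergent subsequence and also provides the
  majorant needed for dominated convergence.
\<close>

lemma (in finite_measure) superposition_continuous_L1:
  fixes f :: "'b::euclidean_space \<Rightarrow> 'c::euclidean_space"
  assumes f: "continuous_on UNIV f" and p: "0 < p"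
    and growth: "\<And>x. norm (f x) \<le> A + B * norm x powr p" and B: "0 \<le> B"
    and \<phi>\<^sub>0: "\<phi>\<^sub>0 \<in> borel_measurable M" "integrable M (\<lambda>s. norm (\<phi>\<^sub>0 s) powr p)"
    and \<epsilon>: "0 < \<epsilon>"
  shows "\<exists>\<delta>>0. \<forall>\<phi>\<in>borel_measurable M. integrable M (\<lambda>s. norm (\<phi> s) powr p) \<longrightarrow>
    (LINT s|M. norm (\<phi> s - \<phi>\<^sub>0 s) powr p) < \<delta> \<longrightarrow>
    (LINT s|M. norm (f (\<phi> s) - f (\<phi>\<^sub>0 s))) < \<epsilon>"
proof (rule ccontr)
  assume "\<not> ?thesis"
  then have neg: "\<exists>\<phi>. \<phi> \<in> borel_measurable M \<and> integrable M (\<lambda>s. norm (\<phi> s) powr p) \<and>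
      (LINT s|M. norm (\<phi> s - \<phi>\<^sub>0 s) powr p) < \<delta> \<and>
      \<epsilon> \<le> (LINT s|M. norm (f (\<phi> s) - f (\<phi>\<^sub>0 s)))" if "0 < \<delta>" for \<delta>
    using that by (simp add: not_less) (meson not_less)
  have "\<forall>n::nat. \<exists>\<phi>. \<phi> \<in> borel_measurable M \<and> integrable M (\<lambda>s. norm (\<phi> s) powr p) \<and>
      (LINT s|M. norm (\<phi> s - \<phi>\<^sub>0 s) powr p) < (1/2) ^ n \<and>
      \<epsilon> \<le> (LINT s|M. norm (f (\<phi> s) - f (\<phi>\<^sub>0 s)))"
    by (intro allI neg) simp
  from choice[OF this] obtain \<phi> where \<phi>[measurable]: "\<And>n. \<phi> n \<in> borel_measurable M"
    and \<phi>_int: "\<And>n. integrable M (\<lambda>s. norm (\<phi> n s) powr p)"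
    and close: "\<And>n. (LINT s|M. norm (\<phi> n s - \<phi>\<^sub>0 s) powr p) < (1/2) ^ n"
    and far: "\<And>n. \<epsilon> \<le> (LINT s|M. norm (f (\<phi> n s) - f (\<phi>\<^sub>0 s)))"
    by blast
  note [measurable] = \<phi>\<^sub>0(1) borel_measurable_continuous_onI[OF f]
  define g where "g = (\<lambda>n s. norm (\<phi> n s - \<phi>\<^sub>0 s) powr p)"
  have g_int: "integrable M (g n)" for n
    unfolding g_def using \<phi> \<phi>_int \<phi>\<^sub>0 p by (intro integrable_norm_diff_powr) auto
  have summable_int: "summable (\<lambda>n. integral\<^sup>L M (g n))"
  proof (rule summable_comparison_test)
    show "\<exists>N. \<forall>n\<ge>N. norm (integral\<^sup>L M (g n)) \<le> (1/2) ^ n"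
      using close by (auto simp: g_def integral_nonneg_AE intro!: exI[of _ 0] less_imp_le)
  qed (simp add: summable_geometric)
  have summable_AE: "AE s in M. summable (\<lambda>n. g n s)"
    using AE_summable_if_summable_integral[OF g_int _ summable_int] by (simp add: g_def)
  have h_int: "integrable M (\<lambda>s. \<Sum>n. g n s)"
    using summable_AE summable_int by (intro integrable_suminf g_int) (simp_all add: g_def)
  \<comment> \<open>The growth bound for \<open>f (\<phi> n s)\<close> and for \<open>f (\<phi>\<^sub>0 s)\<close>, with \<open>norm (\<phi> n s) powr p\<close> estimated by
     \<open>norm_powr_le_sum\<close> and the single term \<open>g n s\<close> by the whole series.\<close>
  define w where "w s = (2 * A + (B * 2 powr p + B) * norm (\<phi>\<^sub>0 s) powr p) + B * 2 powr p * (\<Sum>n. g n s)" for s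
  have "(\<lambda>n. LINT s|M. norm (f (\<phi> n s) - f (\<phi>\<^sub>0 s))) \<longlonglongrightarrow> (LINT s|M. 0)"
  proof (rule integral_dominated_convergence[where w = w])
    show "integrable M w"
      unfolding w_def using \<phi>\<^sub>0(2) h_int by simp
    show "AE s in M. (\<lambda>n. norm (f (\<phi> n s) - f (\<phi>\<^sub>0 s))) \<longlonglongrightarrow> 0"
      using summable_AE
    proof eventually_elim
      case (elim s)
      then have "(\<lambda>n. g n s) \<longlonglongrightarrow> 0"
        by (rule summable_LIMSEQ_zero)
      then have "(\<lambda>n. g n s powr (1 / p)) \<longlonglongrightarrow> 0"
        using p by (intro tendsto_zero_powrI[OF _ tendsto_const]) (auto simp: g_def)
      then have "(\<lambda>n. \<phi> n s) \<longlonglongrightarrow> \<phi>\<^sub>0 s"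
        using p by (simp add: g_def powr_powr LIM_zero_iff tendsto_norm_zero_iff)
      then have "(\<lambda>n. f (\<phi> n s)) \<longlonglongrightarrow> f (\<phi>\<^sub>0 s)"
        using f by (intro continuous_on_tendsto_compose[where s = UNIV and f = f]) auto
      then show ?case
        by (simp add: LIM_zero_iff tendsto_norm_zero_iff)
    qed
    show "AE s in M. norm (norm (f (\<phi> n s) - f (\<phi>\<^sub>0 s))) \<le> w s" for n
      using summable_AE
    proof eventually_elim
      case (elim s)
      have "g n s \<le> (\<Sum>n. g n s)"
        using sum_le_suminf[OF elim, of "{n}"] by (simp add: g_def)
      then have "2 powr p * (norm (\<phi>\<^sub>0 s) powr p + g n s) \<le> 2 powr p * (norm (\<phi>\<^sub>0 s) powr p + (\<Sum>n. g n s))"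
        by (intro mult_left_mono add_left_mono) auto
      with norm_powr_le_sum[of p "\<phi> n s" "\<phi>\<^sub>0 s"] p
      have "norm (\<phi> n s) powr p \<le> 2 powr p * (norm (\<phi>\<^sub>0 s) powr p + (\<Sum>n. g n s))"
        unfolding g_def by linarith
      then have "B * norm (\<phi> n s) powr p \<le> B * (2 powr p * (norm (\<phi>\<^sub>0 s) powr p + (\<Sum>n. g n s)))"
        using B by (rule mult_left_mono)
      then show ?case
        using growth[of "\<phi> n s"] growth[of "\<phi>\<^sub>0 s"] norm_triangle_ineq4[of "f (\<phi> n s)" "f (\<phi>\<^sub>0 s)"]
        unfolding w_def by (simp add: algebra_simps)
    qed
  qed measurable
  then show False
    using far \<epsilon> LIMSEQ_le_const[of _ 0 \<epsilon>] by force
qed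

section \<open>Existence and uniqueness by the method of steps\<close>

lemma has_bochner_integral_shift_Icc:
  fixes g :: "real \<Rightarrow> 'a::euclidean_space"
  shows "has_bochner_integral (lebesgue_on {a..b}) (\<lambda>s. g (s - r)) i \<longleftrightarrow>
    has_bochner_integral (lebesgue_on {a - r..b - r}) g i"
proof -
  have "indicator {a - r..b - r} (- r + 1 * s) = (indicator {a..b} s :: real)" for s
    by (auto simp: indicator_def)
  then show ?thesis
    using has_bochner_integral_lebesgue_real_affine_iff
      [of 1 "\<lambda>s. indicator {a - r..b - r} s *\<^sub>R g s" i "- r"]
    by (simp add: has_bochner_integral_restrict_space)
qed

lemma integrable_shift_Icc:
  fixes g :: "real \<Rightarrow> 'a::euclidean_space"
  shows "integrable (lebesgue_on {a..b}) (\<lambda>s. g (s - r)) \<longleftrightarrow> integrable (lebesgue_on {a - r..b - r}) g"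
  by (simp add: integrable.simps has_bochner_integral_shift_Icc)

lemma integral_shift_Icc:
  fixes g :: "real \<Rightarrow> 'a::euclidean_space"
  shows "(LINT s|lebesgue_on {a..b}. g (s - r)) = integral\<^sup>L (lebesgue_on {a - r..b - r}) g"
  using has_bochner_integral_shift_Icc[of a b g r]
  by (metis has_bochner_integral_iff not_integrable_integral_eq)

lemma integral_lebesgue_on_point [simp]:
  fixes g :: "real \<Rightarrow> 'a::euclidean_space"
  shows "integral\<^sup>L (lebesgue_on {a}) g = 0"
  by (rule has_bochner_integral_integral_eq) simp

text \<open>
  The delayed argument runs through \<open>[- r, t - r]\<close>. On the part in \<open>[- R, 0]\<close> the integrability is that of
  \<open>f \<circ> \<phi>\<close>, as \<open>\<phi>\<close> need not be continuous; on the part in \<open>[0, t]\<close> it comes from the continuity of \<open>x\<close>.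
\<close>

lemma integrable_delayed:
  fixes f :: "real^'n \<Rightarrow> real^'n" and r R t :: real
  assumes f: "continuous_on UNIV f" and r: "0 < r" "r \<le> R" and t: "0 \<le> t"
    and \<phi>: "integrable (lebesgue_on {- R..0}) (\<lambda>s. f (\<phi> s))"
    and x: "\<And>s. - R \<le> s \<Longrightarrow> s \<le> 0 \<Longrightarrow> x s = \<phi> s" "continuous_on {0..} x"
  shows "integrable (lebesgue_on {0..t}) (\<lambda>s. f (x (s - r)))"
proof -
  have "integrable (lebesgue_on {- R..0}) (\<lambda>s. f (x s))"
    using \<phi> by (rule Bochner_Integration.integrable_cong[THEN iffD1, rotated -1]) (auto simp: x)
  moreover have "continuous_on {0..t} x"
    using x(2) by (rule continuous_on_subset) auto
  then have "continuous_on {0..t} (\<lambda>s. f (x s))"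
    using continuous_on_compose2[OF f] by blast
  then have "integrable (lebesgue_on {0..t}) (\<lambda>s. f (x s))"
    by (rule continuous_imp_integrable_real)
  ultimately have "integrable (lebesgue_on {- R..t}) (\<lambda>s. f (x s))"
    by (rule integrable_combine) (use r t in simp_all)
  then have "integrable (lebesgue_on {0 - r..t - r}) (\<lambda>s. f (x s))"
    by (rule integrable_subinterval) (use r in auto)
  then show ?thesis
    using integrable_shift_Icc[of 0 t "\<lambda>s. f (x s)" r] by simp
qed

lemma continuous_on_atLeastI:
  fixes g :: "real \<Rightarrow> 'a::topological_space"
  assumes "\<And>b. continuous_on {a..b} g"
  shows "continuous_on {a..} g"
  unfolding continuous_on_def
proof
  fix t assume t: "t \<in> {a..}"
  have "at t within {a..} = at t within {a..t + 1}"
    by (rule at_within_nhd[of t "{..<t + 1}"]) auto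
  then show "(g \<longlongrightarrow> g t) (at t within {a..})"
    using assms[of "t + 1"] t by (simp add: continuous_on_def)
qed

text \<open>
  The Picard iterates of the integral equation. Because of the delay they do not merely converge: the
  \<open>k\<close>-th iterate is already the solution up to time \<open>k r\<close>. This turns the method of steps into a recursion
  over functions on the whole line.
\<close>

primrec delay_iter :: "(real^'n \<Rightarrow> real^'n) \<Rightarrow> (real \<Rightarrow> real^'n) \<Rightarrow> real \<Rightarrow> nat \<Rightarrow> real \<Rightarrow> real^'n" where
  "delay_iter f \<phi> r 0 = static_prolongation \<phi>"
| "delay_iter f \<phi> r (Suc k) = (\<lambda>t. if t \<le> 0 then \<phi> t
     else \<phi> 0 + (LINT s|lebesgue_on {0..t}. f (delay_iter f \<phi> r k (s - r))))"

lemma delay_iter_history: "t \<le> 0 \<Longrightarrow> delay_iter f \<phi> r k t = \<phi> t"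
  by (cases k) (auto simp: static_prolongation_def)

lemma delay_iter_continuous:
  assumes "continuous_on UNIV f" and "0 < r" "r \<le> R"
    and "integrable (lebesgue_on {- R..0}) (\<lambda>s. f (\<phi> s))"
  shows "continuous_on {0..} (delay_iter f \<phi> r k)"
proof (induction k)
  case 0
  have "continuous_on {0..} (\<lambda>_::real. \<phi> 0)"
    by simp
  then show ?case
    by (rule continuous_on_eq) (simp add: static_prolongation_def)
next
  case (Suc k)
  show ?case
  proof (rule continuous_on_atLeastI)
    fix b :: real
    show "continuous_on {0..b} (delay_iter f \<phi> r (Suc k))"
    proof (cases "0 \<le> b")
      case True
      then have "integrable (lebesgue_on {0..b}) (\<lambda>s. f (delay_iter f \<phi> r k (s - r)))"
        using assms Suc by (intro integrable_delayed) (auto simp: delay_iter_history)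
      then have "continuous_on {0..b} (\<lambda>t. \<phi> 0 + (LINT s|lebesgue_on {0..t}. f (delay_iter f \<phi> r k (s - r))))"
        by (intro continuous_intros indefinite_integral_continuous_real)
      then show ?thesis
        by (rule continuous_on_eq) auto
    qed simp
  qed
qed

text \<open>
  For \<open>s \<le> t \<le> (k + 1) r\<close> the delayed time \<open>s - r\<close> is at most \<open>k r\<close>, where the iterates that enter the
  integral already agree.
\<close>

lemma delay_iter_stable:
  assumes r: "0 < r" and t: "t \<le> real k * r" and "k \<le> m"
  shows "delay_iter f \<phi> r m t = delay_iter f \<phi> r k t"
  using t \<open>k \<le> m\<close>
proof (induction k arbitrary: m t)
  case 0
  then show ?case
    by (simp add: delay_iter_history static_prolongation_def)
next
  case (Suc k)
  then obtain m' where m: "m = Suc m'" "k \<le> m'"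
    by (cases m) auto
  have "delay_iter f \<phi> r m' (s - r) = delay_iter f \<phi> r k (s - r)" if "s \<le> t" for s
    using Suc.prems(1) that m(2) by (intro Suc.IH) (simp_all add: algebra_simps)
  then have "(LINT s|lebesgue_on {0..t}. f (delay_iter f \<phi> r m' (s - r))) =
      (LINT s|lebesgue_on {0..t}. f (delay_iter f \<phi> r k (s - r)))"
    by (intro Bochner_Integration.integral_cong) auto
  then show ?case
    by (simp add: m)
qed

lemma is_solution_exists:
  fixes f :: "real^'n \<Rightarrow> real^'n"
  assumes f: "continuous_on UNIV f" and r: "0 < r" "r \<le> R"
    and \<phi>: "integrable (lebesgue_on {- R..0}) (\<lambda>s. f (\<phi> s))"
  shows "\<exists>x. is_solution f R \<phi> r x"
proof -
  define X where "X = delay_iter f \<phi> r"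
  \<comment> \<open>At time \<open>t\<close> the iterates are constant from the index \<open>\<lceil>t / r\<rceil>\<close> on; for \<open>t \<le> 0\<close> this index is \<open>0\<close>.\<close>
  define x where "x = restrict (\<lambda>t. X (nat \<lceil>t / r\<rceil>) t) {- R..}"
  have x_eq: "x t = X k t" if "- R \<le> t" "t \<le> real k * r" for t k
  proof -
    have "t / r \<le> real k"
      using that r by (simp add: field_simps)
    then have "nat \<lceil>t / r\<rceil> \<le> k"
      by linarith
    moreover have "t / r \<le> real (nat \<lceil>t / r\<rceil>)"
      by linarith
    then have "t \<le> real (nat \<lceil>t / r\<rceil>) * r"
      using r by (simp add: field_simps)
    ultimately show ?thesis
      using delay_iter_stable[OF r(1), of t "nat \<lceil>t / r\<rceil>" k f \<phi>] that by (simp add: x_def X_def)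
  qed
  have hist: "x t = \<phi> t" if "- R \<le> t" "t \<le> 0" for t
    using x_eq[of t 0] that by (simp add: X_def static_prolongation_def)
  have reach: "\<exists>k. t \<le> real k * r" for t
    using reals_Archimedean3[OF r(1), rule_format, of t] less_imp_le by blast
  have cont: "continuous_on {0..} x"
  proof (rule continuous_on_atLeastI)
    fix b
    obtain k where k: "b \<le> real k * r"
      using reach by blast
    have "continuous_on {0..b} (X k)"
      using delay_iter_continuous[OF f r \<phi>, of k] unfolding X_def by (rule continuous_on_subset) auto
    then show "continuous_on {0..b} x"
    proof (rule continuous_on_eq)
      fix t assume "t \<in> {0..b}"
      then show "X k t = x t"
        using x_eq[of t k] k r by simp
    qed
  qed
  have "x t = \<phi> 0 + (LINT s|lebesgue_on {0..t}. f (x (s - r)))" if t: "0 \<le> t" for t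
  proof (cases "t = 0")
    case True
    then show ?thesis
      using hist[of 0] r by simp
  next
    case False
    obtain k where k: "t \<le> real k * r"
      using reach by blast
    have "x (s - r) = X k (s - r)" if "s \<in> {0..t}" for s
      using x_eq[of "s - r" k] k that r by simp
    then have "(LINT s|lebesgue_on {0..t}. f (x (s - r))) = (LINT s|lebesgue_on {0..t}. f (X k (s - r)))"
      by (intro Bochner_Integration.integral_cong) auto
    moreover have "x t = X (Suc k) t"
      using x_eq[of t "Suc k"] k t r by (simp add: algebra_simps)
    ultimately show ?thesis
      using False t by (simp add: X_def)
  qed
  moreover have "x \<in> extensional {- R..}"
    by (simp add: x_def)
  moreover have "integrable (lebesgue_on {0..t}) (\<lambda>s. f (x (s - r)))" if "0 \<le> t" for t
    using f r that \<phi> hist cont by (rule integrable_delayed)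
  ultimately have "is_solution f R \<phi> r x"
    using hist cont by (simp add: is_solution_def)
  then show ?thesis
    by blast
qed

text \<open>
  Two solutions agree on \<open>[- R, k r]\<close> by induction on \<open>k\<close>, since the integral equation determines the
  values up to \<open>(k + 1) r\<close> by those up to \<open>k r\<close>. To the left of \<open>- R\<close> they agree by extensionality.
\<close>

lemma is_solution_unique:
  assumes r: "0 < r" "r \<le> R" and x: "is_solution f R \<phi> r x" and y: "is_solution f R \<phi> r y"
  shows "x = y"
proof
  have eq: "x t = y t" if "- R \<le> t" "t \<le> real k * r" for t k
    using that
  proof (induction k arbitrary: t)
    case 0
    then show ?case
      using x y by (simp add: is_solution_def)
  next
    case (Suc k)
    show ?case
    proof (cases "t \<le> 0")
      case True
      then show ?thesis
        using x y Suc.prems by (simp add: is_solution_def)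
    next
      case False
      have "x (s - r) = y (s - r)" if "s \<in> {0..t}" for s
        using Suc.prems that r by (intro Suc.IH) (auto simp: algebra_simps)
      then have "(LINT s|lebesgue_on {0..t}. f (x (s - r))) = (LINT s|lebesgue_on {0..t}. f (y (s - r)))"
        by (intro Bochner_Integration.integral_cong) auto
      with False show ?thesis
        using x y by (simp add: is_solution_def)
    qed
  qed
  fix t
  obtain k where "t \<le> real k * r"
    using reals_Archimedean3[OF r(1), rule_format, of t] less_imp_le by blast
  then show "x t = y t"
    using eq[of t k] x y extensional_arb[of x "{- R..}" t] extensional_arb[of y "{- R..}" t]
    by (cases "- R \<le> t") (auto simp: is_solution_def)
qed

lemma is_solution_solution:
  fixes f :: "real^'n \<Rightarrow> real^'n"
  assumes "continuous_on UNIV f" and "0 < r" "r \<le> R"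
    and "integrable (lebesgue_on {- R..0}) (\<lambda>s. f (\<phi> s))"
  shows "is_solution f R \<phi> r (solution f R \<phi> r)"
proof -
  obtain x where x: "is_solution f R \<phi> r x"
    using is_solution_exists[OF assms] by (rule exE)
  have "is_solution f R \<phi> r (THE x. is_solution f R \<phi> r x)"
    by (rule theI[of "is_solution f R \<phi> r", OF x]) (rule is_solution_unique[OF assms(2,3) _ x])
  then show ?thesis
    by (simp only: solution_def)
qed

section \<open>Continuous dependence on the history\<close>

text \<open>
  Up to time \<open>r\<close> the delayed solution in the integrand is the history itself, and the substitution
  \<open>s \<mapsto> s - r\<close> moves the delay from the integrand into the interval of integration. For \<open>t < 0\<close> the interval
  \<open>{- r..t - r}\<close> is empty, so that the formula also covers \<open>y = 0\<close> on \<open>[- R, 0]\<close>.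
\<close>

lemma solution_y_first_step:
  fixes f :: "real^'n \<Rightarrow> real^'n"
  assumes f: "continuous_on UNIV f" and r: "0 < r" "r \<le> R" and t: "- R \<le> t" "t \<le> r"
    and \<phi>: "integrable (lebesgue_on {- R..0}) (\<lambda>s. f (\<phi> s))"
  shows "solution_y f R \<phi> r t = integral\<^sup>L (lebesgue_on {- r..t - r}) (\<lambda>s. f (\<phi> s))"
proof -
  note sol = is_solution_solution[OF f r \<phi>, unfolded is_solution_def]
  show ?thesis
  proof (cases "0 \<le> t")
    case True
    have "(LINT s|lebesgue_on {0..t}. f (solution f R \<phi> r (s - r))) = (LINT s|lebesgue_on {0..t}. f (\<phi> (s - r)))"
      using sol t r by (intro Bochner_Integration.integral_cong) auto
    also have "\<dots> = integral\<^sup>L (lebesgue_on {- r..t - r}) (\<lambda>s. f (\<phi> s))"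
      using integral_shift_Icc[of 0 t "\<lambda>s. f (\<phi> s)" r] by simp
    moreover have "static_prolongation \<phi> t = \<phi> 0"
      using True by (simp add: static_prolongation_def)
    ultimately show ?thesis
      using sol True by (simp add: solution_y_def)
  next
    case False
    then show ?thesis
      using sol t by (simp add: solution_y_def static_prolongation_def)
  qed
qed

theorem theorem3p3:
  fixes nrm :: "real^'n \<Rightarrow> real" and f :: "real^'n \<Rightarrow> real^'n" and R T \<alpha> :: real
  assumes "is_norm nrm"
    and "0 < R" and "0 < T" and "T < R"
    and "continuous_on UNIV f"
    and "1 \<le> \<alpha>"
    and "\<exists>C>0. \<exists>K>0. \<forall>x. K \<le> nrm x \<longrightarrow> nrm (f x) \<le> C * nrm x powr \<alpha>"
  shows "(\<forall>\<phi>\<in>Lp_space nrm \<alpha> (- R) 0. \<forall>r\<in>{T..R}. continuous_on {- R..T} (solution_y f R \<phi> r)) \<and>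
    (\<forall>\<phi>\<^sub>0\<in>Lp_space nrm \<alpha> (- R) 0. \<forall>\<epsilon>>0. \<exists>\<delta>>0. \<forall>\<phi>\<in>Lp_space nrm \<alpha> (- R) 0.
       Lp_seminorm nrm \<alpha> (- R) 0 (\<lambda>\<theta>. \<phi> \<theta> - \<phi>\<^sub>0 \<theta>) < \<delta> \<longrightarrow>
       (\<forall>r\<in>{T..R}. sup_norm nrm (- R) T (\<lambda>t. solution_y f R \<phi> r t - solution_y f R \<phi>\<^sub>0 r t) < \<epsilon>))"
proof -
  note f = assms(5)
  have \<alpha>: "0 < \<alpha>"
    using assms(6) by simp
  let ?M = "lebesgue_on {- R..0}"
  interpret finite_measure ?M
    by (rule finite_measure_lebesgue_on) simp
  obtain c where nrm_cont: "continuous_on UNIV nrm" and c: "0 < c"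
    and nrm_le: "\<And>x. nrm x \<le> c * norm x" and norm_le: "\<And>x. norm x \<le> c * nrm x"
    by (rule is_norm_equivalent[OF assms(1)]) (rule that)
  have nrm_nonneg: "0 \<le> nrm x" for x
    using assms(1) by (simp add: is_norm_def)
  have nrm_powr: "nrm x powr \<alpha> \<le> c powr \<alpha> * norm x powr \<alpha>" for x
    using powr_mono2[OF _ nrm_nonneg nrm_le, of \<alpha> x] \<alpha> c by (simp add: powr_mult nrm_nonneg)
  have norm_powr: "norm x powr \<alpha> \<le> c powr \<alpha> * nrm x powr \<alpha>" for x
    using powr_mono2[OF _ norm_ge_zero norm_le, of \<alpha> x] \<alpha> c nrm_nonneg by (simp add: powr_mult)

  obtain A B where B: "0 \<le> B" and growth: "\<And>x. norm (f x) \<le> A + B * norm x powr \<alpha>"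
  proof -
    \<comment> \<open>Where \<open>nrm x < K\<close>, the point \<open>x\<close> lies in a Euclidean ball, on which \<open>f\<close> is bounded by continuity.\<close>
    obtain C K where C: "C > 0" and K: "\<And>x. K \<le> nrm x \<Longrightarrow> nrm (f x) \<le> C * nrm x powr \<alpha>"
      using assms(7) by blast
    have "compact (f ` cball 0 (c * K))"
      using f by (intro compact_continuous_image) (auto intro: continuous_on_subset)
    then have "bounded (f ` cball 0 (c * K))"
      by (rule compact_imp_bounded)
    then obtain A where A: "0 < A" "\<And>x. x \<in> cball 0 (c * K) \<Longrightarrow> norm (f x) \<le> A"
      unfolding bounded_pos by blast
    show thesis
    proof
      let ?B = "c * (C * c powr \<alpha>)"
      show "0 \<le> ?B"
        using c C by simp
      show "norm (f x) \<le> A + ?B * norm x powr \<alpha>" for x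
      proof (cases "K \<le> nrm x")
        case True
        have "norm (f x) \<le> c * nrm (f x)"
          by (rule norm_le)
        also have "\<dots> \<le> c * (C * nrm x powr \<alpha>)"
          using K[OF True] c by simp
        also have "\<dots> \<le> c * (C * (c powr \<alpha> * norm x powr \<alpha>))"
          using nrm_powr[of x] c C by simp
        finally show ?thesis
          using A(1) by (simp add: mult.assoc)
      next
        case False
        then have "c * nrm x \<le> c * K"
          using c by simp
        then have "x \<in> cball 0 (c * K)"
          using norm_le[of x] by simp
        then have "norm (f x) \<le> A"
          by (rule A(2))
        moreover have "0 \<le> ?B * norm x powr \<alpha>"
          using c C by simp
        ultimately show ?thesis
          by linarith
      qed
    qed
  qed

  have meas: "\<phi> \<in> borel_measurable ?M" and
    norm_int: "integrable ?M (\<lambda>s. norm (\<phi> s) powr \<alpha>)"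
    if "\<phi> \<in> Lp_space nrm \<alpha> (- R) 0" for \<phi>
  proof -
    show [measurable]: "\<phi> \<in> borel_measurable ?M"
      using that by (simp add: Lp_space_def)
    show "integrable ?M (\<lambda>s. norm (\<phi> s) powr \<alpha>)"
    proof (rule Bochner_Integration.integrable_bound)
      show "integrable ?M (\<lambda>s. c powr \<alpha> * nrm (\<phi> s) powr \<alpha>)"
        using that by (simp add: Lp_space_def)
      show "(\<lambda>s. norm (\<phi> s) powr \<alpha>) \<in> borel_measurable ?M"
        by measurable
      show "AE s in ?M. norm (norm (\<phi> s) powr \<alpha>) \<le> norm (c powr \<alpha> * nrm (\<phi> s) powr \<alpha>)"
        using order_trans[OF norm_powr abs_ge_self] by simp
    qed
  qed
  have f_int: "integrable ?M (\<lambda>s. f (\<phi> s))" if "\<phi> \<in> Lp_space nrm \<alpha> (- R) 0" for \<phi>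
    using f growth meas[OF that] norm_int[OF that] by (rule superposition_integrable)
  have y_eq: "solution_y f R \<phi> r t = integral\<^sup>L (lebesgue_on {- r..t - r}) (\<lambda>s. f (\<phi> s))"
    if "\<phi> \<in> Lp_space nrm \<alpha> (- R) 0" "r \<in> {T..R}" "t \<in> {- R..T}" for \<phi> r t
    by (rule solution_y_first_step[OF f]) (use that assms(3) f_int in simp_all)

  show ?thesis
  proof (intro conjI ballI allI impI)
    fix \<phi> r
    assume \<phi>: "\<phi> \<in> Lp_space nrm \<alpha> (- R) 0" and r: "r \<in> {T..R}"
    have cont: "continuous_on {- r..T - r} (\<lambda>u. integral\<^sup>L (lebesgue_on {- r..u}) (\<lambda>s. f (\<phi> s)))"
      using r assms(3) by (intro indefinite_integral_continuous_real integrable_subinterval[OF f_int[OF \<phi>]]) auto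
    have "continuous_on ({- R..0} \<union> {0..T}) (solution_y f R \<phi> r)"
    proof (rule continuous_on_closed_Un)
      have "continuous_on {- R..0} (\<lambda>_::real. 0 :: real^'n)"
        by simp
      then show "continuous_on {- R..0} (solution_y f R \<phi> r)"
      proof (rule continuous_on_eq)
        fix t :: real assume t: "t \<in> {- R..0}"
        show "0 = solution_y f R \<phi> r t"
          using y_eq[OF \<phi> r, of t] t assms(3)
          by (cases "t = 0") auto
      qed
      have "continuous_on {0..T} (\<lambda>t. integral\<^sup>L (lebesgue_on {- r..t - r}) (\<lambda>s. f (\<phi> s)))"
        by (rule continuous_on_compose2[OF cont]) (auto intro!: continuous_intros)
      then show "continuous_on {0..T} (solution_y f R \<phi> r)"
        by (rule continuous_on_eq) (use y_eq[OF \<phi> r] assms(2) in auto)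
    qed auto
    then show "continuous_on {- R..T} (solution_y f R \<phi> r)"
      using assms(2,3) by (simp add: ivl_disj_un_two_touch)
  next
    fix \<phi>\<^sub>0 and \<epsilon> :: real
    assume \<phi>\<^sub>0: "\<phi>\<^sub>0 \<in> Lp_space nrm \<alpha> (- R) 0" and \<epsilon>: "0 < \<epsilon>"
    have "0 < \<epsilon> / (2 * c)"
      using \<epsilon> c by simp
    from superposition_continuous_L1[OF f \<alpha> growth B meas[OF \<phi>\<^sub>0] norm_int[OF \<phi>\<^sub>0] this]
    obtain \<delta> where \<delta>: "0 < \<delta>" and close: "\<And>\<phi>. \<phi> \<in> borel_measurable ?M \<Longrightarrow>
        integrable ?M (\<lambda>s. norm (\<phi> s) powr \<alpha>) \<Longrightarrow>
        (LINT s|?M. norm (\<phi> s - \<phi>\<^sub>0 s) powr \<alpha>) < \<delta> \<Longrightarrow>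
        (LINT s|?M. norm (f (\<phi> s) - f (\<phi>\<^sub>0 s))) < \<epsilon> / (2 * c)"
      by blast
    \<comment> \<open>The factor \<open>c powr \<alpha>\<close> is the loss in passing from \<open>nrm\<close> to the Euclidean norm under the integral; the
       factor \<open>c\<close> in \<open>\<epsilon> / (2 * c)\<close> pays for the way back, and the \<open>2\<close> keeps the supremum strictly below \<open>\<epsilon>\<close>.\<close>
    show "\<exists>\<delta>>0. \<forall>\<phi>\<in>Lp_space nrm \<alpha> (- R) 0.
       Lp_seminorm nrm \<alpha> (- R) 0 (\<lambda>\<theta>. \<phi> \<theta> - \<phi>\<^sub>0 \<theta>) < \<delta> \<longrightarrow>
       (\<forall>r\<in>{T..R}. sup_norm nrm (- R) T (\<lambda>t. solution_y f R \<phi> r t - solution_y f R \<phi>\<^sub>0 r t) < \<epsilon>)"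
    proof (intro exI[of _ "(\<delta> / c powr \<alpha>) powr (1 / \<alpha>)"] conjI ballI impI)
      show "0 < (\<delta> / c powr \<alpha>) powr (1 / \<alpha>)"
        using \<delta> c by simp
      fix \<phi> r
      assume \<phi>: "\<phi> \<in> Lp_space nrm \<alpha> (- R) 0" and r: "r \<in> {T..R}"
        and near: "Lp_seminorm nrm \<alpha> (- R) 0 (\<lambda>\<theta>. \<phi> \<theta> - \<phi>\<^sub>0 \<theta>) < (\<delta> / c powr \<alpha>) powr (1 / \<alpha>)"
      let ?I = "LINT s|?M. nrm (\<phi> s - \<phi>\<^sub>0 s) powr \<alpha>"
      have diff_int: "integrable ?M (\<lambda>s. norm (\<phi> s - \<phi>\<^sub>0 s) powr \<alpha>)"
        using meas norm_int \<phi> \<phi>\<^sub>0 \<alpha> by (intro integrable_norm_diff_powr) auto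
      have nrm_diff_int: "integrable ?M (\<lambda>s. nrm (\<phi> s - \<phi>\<^sub>0 s) powr \<alpha>)"
      proof (rule Bochner_Integration.integrable_bound)
        show "integrable ?M (\<lambda>s. c powr \<alpha> * norm (\<phi> s - \<phi>\<^sub>0 s) powr \<alpha>)"
          using diff_int by simp
        note [measurable] = meas[OF \<phi>] meas[OF \<phi>\<^sub>0] borel_measurable_continuous_onI[OF nrm_cont]
        show "(\<lambda>s. nrm (\<phi> s - \<phi>\<^sub>0 s) powr \<alpha>) \<in> borel_measurable ?M"
          by measurable
        show "AE s in ?M. norm (nrm (\<phi> s - \<phi>\<^sub>0 s) powr \<alpha>) \<le> norm (c powr \<alpha> * norm (\<phi> s - \<phi>\<^sub>0 s) powr \<alpha>)"
          using order_trans[OF nrm_powr abs_ge_self] by simp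
      qed
      have "?I < \<delta> / c powr \<alpha>"
      proof (rule ccontr)
        assume "\<not> ?thesis"
        then have "(\<delta> / c powr \<alpha>) powr (1 / \<alpha>) \<le> ?I powr (1 / \<alpha>)"
          using \<delta> c \<alpha> by (intro powr_mono2) auto
        with near show False
          by (simp add: Lp_seminorm_def)
      qed
      then have "c powr \<alpha> * ?I < \<delta>"
        using c by (simp add: field_simps)
      moreover have "(LINT s|?M. norm (\<phi> s - \<phi>\<^sub>0 s) powr \<alpha>) \<le> (LINT s|?M. c powr \<alpha> * nrm (\<phi> s - \<phi>\<^sub>0 s) powr \<alpha>)"
        using diff_int nrm_diff_int norm_powr by (intro integral_mono) auto
      ultimately have small: "(LINT s|?M. norm (f (\<phi> s) - f (\<phi>\<^sub>0 s))) < \<epsilon> / (2 * c)"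
        using meas[OF \<phi>] norm_int[OF \<phi>] by (intro close) auto
      have "nrm (solution_y f R \<phi> r t - solution_y f R \<phi>\<^sub>0 r t) \<le> \<epsilon> / 2" if t: "t \<in> {- R..T}" for t
      proof -
        let ?L = "lebesgue_on {- r..t - r}"
        have sub: "{- r..t - r} \<subseteq> {- R..0}"
          using r t by auto
        have "norm (solution_y f R \<phi> r t - solution_y f R \<phi>\<^sub>0 r t) = norm (LINT s|?L. f (\<phi> s) - f (\<phi>\<^sub>0 s))"
          using integrable_subinterval[OF f_int[OF \<phi>] sub] integrable_subinterval[OF f_int[OF \<phi>\<^sub>0] sub]
          by (simp add: y_eq[OF \<phi> r t] y_eq[OF \<phi>\<^sub>0 r t])
        also have "\<dots> \<le> (LINT s|?L. norm (f (\<phi> s) - f (\<phi>\<^sub>0 s)))"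
          by (rule integral_norm_bound)
        also have "\<dots> \<le> (LINT s|?M. norm (f (\<phi> s) - f (\<phi>\<^sub>0 s)))"
          using sub f_int[OF \<phi>] f_int[OF \<phi>\<^sub>0] by (intro integral_mono_lebesgue_on_AE) auto
        also note small
        finally have "c * norm (solution_y f R \<phi> r t - solution_y f R \<phi>\<^sub>0 r t) \<le> \<epsilon> / 2"
          using c by (simp add: field_simps)
        then show ?thesis
          using nrm_le order_trans by blast
      qed
      then have "sup_norm nrm (- R) T (\<lambda>t. solution_y f R \<phi> r t - solution_y f R \<phi>\<^sub>0 r t) \<le> \<epsilon> / 2"
        using assms(2,3) unfolding sup_norm_def by (intro cSUP_least) auto
      then show "sup_norm nrm (- R) T (\<lambda>t. solution_y f R \<phi> r t - solution_y f R \<phi>\<^sub>0 r t) < \<epsilon>"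
        using \<epsilon> by simp
    qed
  qed
qed

end
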